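(* Let $m\in\mathcal{P}(X)$. Assume that $g$ is bounded and that $f$ is convex and differentiable with Lipschitz continuous gradient (with constant $L$). Let $\bar\mu\in\mathcal{P}_m(Z)$ and $\bar\lambda=\nabla f\left(\int_Z g\,d\bar\mu\right)$. Consider the three assertions: (1) $\bar\mu$ is a solution of the problem $\inf_{\mu\in\mathcal{P}_m(Z)} f\left(\int_Z g\,d\mu\right)$; (2) $\int_Z g_{\bar\lambda}\,d\bar\mu=\inf_{\mu\in\mathcal{P}_m(Z)}\int_Z g_{\bar\lambda}\,d\mu$; (3) $\mathrm{supp}(\bar\mu_x)\subseteq \mathrm{BR}_{\bar\lambda}(x)$ for $m$-a.e. $x\in X$, where $(\bar\mu_x)_{x\in X}$ is the disintegration of $\bar\mu$ with respect to $m$. Then (1) and (2) are equivalent. Moreover, if in addition for every $\lambda\in\mathcal{H}_f:=\nabla f(\mathcal{H})$ the function $g_\lambda$ is lower semi-continuous on $Z$, the set-valued map $G_\lambda$ is lower semi-continuous, and $\mathrm{BR}_\lambda(x)\neq\emptyset$ for all $x\in X$, then (1), (2) and (3) are equivalent.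
   Context: $X$ and $Y$ are complete separable metric spaces with metrics $d_X,d_Y$ and their Borel $\sigma$-algebras; $\mathcal{P}(\cdot)$ denotes the set of Borel probability measures. $F\colon X\rightsquigarrow Y$ is a set-valued map ($F(x)\subseteq Y$) with non-empty values and closed graph; $Z_x:=F(x)$ and $Z:=\{(x,y)\in X\times Y: y\in Z_x\}$. $\mathcal{H}$ is a separable real Hilbert space; $g\colon Z\to\mathcal{H}$ and $f\colon\mathcal{H}\to\mathbb{R}$ are Borel measurable. With $\pi_1(x,y)=x$, $\mathcal{P}_m(Z)=\{\mu\in\mathcal{P}(Z):\pi_1\#\mu=m\}$ ($\#$ is push-forward). Integrals of $g$ are Bochner integrals. A solution of a minimization problem is a minimizer. For $\lambda\in\mathcal{H}$: $g_\lambda(x,y)=\langle\lambda,g(x,y)\rangle$ on $Z$; $G_\lambda\colon X\rightsquigarrow\mathbb{R}$, $G_\lambda(x)=\{g_\lambda(x,y):y\in Z_x\}$; $\mathrm{BR}_\lambda\colon X\rightsquigarrow Y$, $\mathrm{BR}_\lambda(x)=\operatorname{argmin}_{y\in Z_x}g_\lambda(x,y)$. A set-valued map $\Phi$ with non-empty values is lower semi-continuous if for every $x$, every $y\in\Phi(x)$ and every sequence $x_n\to x$ there exist $y_n\in\Phi(x_n)$ with $y_n\to y$. Disintegration: for $\mu\in\mathcal{P}_m(Z)$ there is an $m$-a.e. uniquely determined (measurable) family $(\mu_x)_{x\in X}$ of probability measures on $Y$, with $\mu_x$ concentrated on $Z_x$ for $m$-a.e. $x$, such that $\int_Z h\,d\mu=\int_X\int_{Z_x}h(x,y)\,d\mu_x(y)\,dm(x)$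 for all Borel $h\colon Z\to\mathbb{R}_+$. The support of a measure is the set of points all of whose open neighborhoods have positive measure. *)

theory Defs
  imports "HOL-Probability.Probability"
begin

definition graph_of :: "('a \<Rightarrow> 'b set) \<Rightarrow> ('a \<times> 'b) set" where
  "graph_of F = (SIGMA x:UNIV. F x)"

(* Elements are measures on the subspace Z = graph_of F, not measures on the whole product
   that are concentrated on Z. *)
definition marginal_probs ::
    "('a::topological_space \<Rightarrow> 'b::topological_space set) \<Rightarrow> 'a measure \<Rightarrow> ('a \<times> 'b) measure set" where
  "marginal_probs F m =
     {\<mu> \<in> space (prob_algebra (restrict_space borel (graph_of F))). distr \<mu> borel fst = m}"

(* The gradient is the vector representing the Frechet derivative; it is unspecified at points
   where f is not differentiable. *)
definition gradient :: "('h::real_inner \<Rightarrow> real) \<Rightarrow> 'h \<Rightarrow> 'h" where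
  "gradient f x = (THE D. GDERIV f x :> D)"

definition lsc_on :: "'a::topological_space set \<Rightarrow> ('a \<Rightarrow> real) \<Rightarrow> bool" where
  "lsc_on S f \<longleftrightarrow> (\<forall>z\<in>S. \<forall>c<f z. \<forall>\<^sub>F w in at z within S. c < f w)"

definition lsc_map :: "('a::topological_space \<Rightarrow> 'b::topological_space set) \<Rightarrow> bool" where
  "lsc_map \<Phi> \<longleftrightarrow>
     (\<forall>x. \<forall>y\<in>\<Phi> x. \<forall>xs. xs \<longlonglongrightarrow> x \<longrightarrow>
        (\<exists>ys. (\<forall>n::nat. ys n \<in> \<Phi> (xs n)) \<and> ys \<longlonglongrightarrow> y))"

definition value_map ::
    "('a \<Rightarrow> 'b set) \<Rightarrow> ('a \<times> 'b \<Rightarrow> 'h::real_inner) \<Rightarrow> 'h \<Rightarrow> 'a \<Rightarrow> real set" where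
  "value_map F g lam x = (\<lambda>y. inner lam (g (x, y))) ` F x"

definition best_response ::
    "('a \<Rightarrow> 'b set) \<Rightarrow> ('a \<times> 'b \<Rightarrow> 'h::real_inner) \<Rightarrow> 'h \<Rightarrow> 'a \<Rightarrow> 'b set" where
  "best_response F g lam x = {y. is_arg_min (\<lambda>y. inner lam (g (x, y))) (\<lambda>y. y \<in> F x) y}"

definition is_disintegration ::
    "('a::topological_space \<Rightarrow> 'b::topological_space set) \<Rightarrow> 'a measure \<Rightarrow> ('a \<times> 'b) measure \<Rightarrow>
       ('a \<Rightarrow> 'b measure) \<Rightarrow> bool" where
  "is_disintegration F m \<mu> \<nu> \<longleftrightarrow>
     \<nu> \<in> borel \<rightarrow>\<^sub>M prob_algebra borel \<and>
     (AE x in m. AE y in \<nu> x. y \<in> F x) \<and>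
     (\<forall>h :: 'a \<times> 'b \<Rightarrow> real.
        h \<in> borel_measurable (restrict_space borel (graph_of F)) \<longrightarrow>
        (\<forall>z\<in>graph_of F. 0 \<le> h z) \<longrightarrow>
        (\<integral>\<^sup>+ z. ennreal (h z) \<partial>\<mu>) = (\<integral>\<^sup>+ x. (\<integral>\<^sup>+ y\<in>F x. ennreal (h (x, y)) \<partial>\<nu> x) \<partial>m))"

definition measure_support :: "'b::topological_space measure \<Rightarrow> 'b set" where
  "measure_support M = {y. \<forall>U. open U \<longrightarrow> y \<in> U \<longrightarrow> 0 < emeasure M U}"

end

theory Submission
  imports Defs
begin

text \<open>Write \<open>v\<^sub>0\<close> for the integral of \<open>g\<close> against the given measure. The attainable integrals form a convex set,
  so minimality of \<open>f\<close> at \<open>v\<^sub>0\<close> makes all directional derivatives along it nonnegative, and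
  conversely \<open>f\<close> lies above its tangent at \<open>v\<^sub>0\<close>.

  For the pointwise criterion let \<open>\<phi> x\<close> be the minimum of \<open>g\<^sub>\<lambda>\<close> over the fibre of \<open>x\<close>. Lower
  semicontinuity of the value map makes \<open>\<phi>\<close> upper semicontinuous, so the graph of the best response
  is closed. Such a graph need not have a Borel selector, but it has one up to an \<open>m\<close>-null set; hence
  the infimum equals the integral of \<open>\<phi>\<close>, and it is attained exactly by the measures concentrated
  on the graph of the best response.\<close>

subsection \<open>Measurable selection\<close>

lemma dense_sequence:
  obtains e :: "nat \<Rightarrow> 'b::{metric_space, second_countable_topology}"
  where "\<And>y r. 0 < r \<Longrightarrow> \<exists>i. dist (e i) y < r"
proof -
  obtain D :: "'b set" where D: "countable D"
    and dense: "\<And>X. open X \<Longrightarrow> X \<noteq> {} \<Longrightarrow> \<exists>d\<in>D. d \<in> X"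
    using countable_dense_setE by blast
  have "D \<noteq> {}"
    using dense[of UNIV] by auto
  show thesis
  proof
    fix y :: 'b and r :: real
    assume "0 < r"
    then obtain d where "d \<in> D" "d \<in> ball y r"
      using dense[of "ball y r"] by auto
    then show "\<exists>i. dist (from_nat_into D i) y < r"
      using D \<open>D \<noteq> {}\<close> from_nat_into_surj[of D d] by (auto simp: dist_commute)
  qed
qed

text \<open>Kuratowski--Ryll-Nardzewski scheme: each fibre is cut down, at scale
  \<open>1 / Suc k\<close>, to the first closed ball of a dense sequence that meets it, and
  completeness leaves exactly one point. Closed balls keep the fibres closed, so that measurability
  of the sets of points whose fibre hits a closed set passes from one stage to the next.\<close>

lemma measurable_selector_total:
  fixes D :: "'a \<Rightarrow> 'b::polish_space set"
  assumes closed: "\<And>x. x \<in> space M \<Longrightarrow> closed (D x)"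
    and nonempty: "\<And>x. x \<in> space M \<Longrightarrow> D x \<noteq> {}"
    and hit: "\<And>V. closed V \<Longrightarrow> {x \<in> space M. D x \<inter> V \<noteq> {}} \<in> sets M"
  obtains s where "s \<in> borel_measurable M" "\<And>x. x \<in> space M \<Longrightarrow> s x \<in> D x"
proof -
  obtain e :: "nat \<Rightarrow> 'b" where e: "\<And>y r. 0 < r \<Longrightarrow> \<exists>i. dist (e i) y < r"
    using dense_sequence by blast
  define B where "B k i = cball (e i) (1 / Suc k)" for k i :: nat
  define idx where "idx k S = (LEAST i. S \<inter> B k i \<noteq> {})" for k and S :: "'b set"
  define DD where "DD = rec_nat D (\<lambda>k E x. E x \<inter> B k (idx k (E x)))"
  have DD_0: "DD 0 = D" and DD_Suc: "DD (Suc k) x = DD k x \<inter> B k (idx k (DD k x))" for k x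
    by (simp_all add: DD_def)
  have idx: "S \<inter> B k (idx k S) \<noteq> {}" if "S \<noteq> {}" for k S
  proof -
    from that obtain y where "y \<in> S" by blast
    obtain i where "dist (e i) y < 1 / Suc k" using e[of "1 / Suc k" y] by auto
    with \<open>y \<in> S\<close> have "S \<inter> B k i \<noteq> {}" by (auto simp: B_def intro!: exI[of _ y])
    then show ?thesis unfolding idx_def by (rule LeastI)
  qed
  have DD_closed: "closed (DD k x)" if "x \<in> space M" for k x
    using that by (induction k) (auto simp: DD_0 DD_Suc closed B_def)
  have DD_nonempty: "DD k x \<noteq> {}" if "x \<in> space M" for k x
    using that idx by (induction k) (auto simp: DD_0 DD_Suc nonempty)
  have DD_hit: "{x \<in> space M. DD k x \<inter> V \<noteq> {}} \<in> sets M" if "closed V" for k V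
    using that
  proof (induction k arbitrary: V)
    case 0
    then show ?case by (simp add: DD_0 hit)
  next
    case (Suc k)
    have meas: "{x \<in> space M. DD k x \<inter> B k i \<noteq> {}} \<in> sets M" for i
      using Suc.IH[of "B k i"] by (simp add: B_def)
    have [measurable]: "(\<lambda>x. idx k (DD k x)) \<in> measurable M (count_space UNIV)"
      unfolding idx_def using meas by (intro measurable_Least) (simp add: pred_def)
    have [measurable]: "{x \<in> space M. DD k x \<inter> (B k i \<inter> V) \<noteq> {}} \<in> sets M" for i
      by (intro Suc.IH closed_Int) (auto simp: B_def Suc.prems)
    \<comment> \<open>Where the chosen index is \<open>i\<close>, the new fibre is
      \<open>DD k x \<inter> B k i\<close>. Splitting along the countably many indices reduces to
      stage \<open>k\<close> with the closed test set \<open>B k i \<inter> V\<close>.\<close>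
    have "{x \<in> space M. DD (Suc k) x \<inter> V \<noteq> {}} =
        (\<Union>i. {x \<in> space M. idx k (DD k x) = i} \<inter> {x \<in> space M. DD k x \<inter> (B k i \<inter> V) \<noteq> {}})"
      by (auto simp: DD_Suc)
    also have "\<dots> \<in> sets M"
      by measurable
    finally show ?case .
  qed
  have DD_mono: "m \<le> n \<Longrightarrow> DD n x \<subseteq> DD m x" for m n x
    using lift_Suc_antimono_le[of "\<lambda>n. DD n x" m n] by (simp add: DD_Suc)
  have DD_small: "\<exists>n. \<forall>y\<in>DD n x. \<forall>z\<in>DD n x. dist y z < r" if "0 < r" for r x
  proof -
    obtain k where k: "1 / Suc k < r / 2"
      using \<open>0 < r\<close> nat_approx_posE[of "r / 2"] by auto
    have "dist y z < r" if "y \<in> DD (Suc k) x" "z \<in> DD (Suc k) x" for y z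
    proof -
      let ?c = "e (idx k (DD k x))"
      have "dist ?c y \<le> 1 / Suc k" "dist ?c z \<le> 1 / Suc k"
        using that by (auto simp: DD_Suc B_def)
      with k dist_triangle3[of y z ?c] show ?thesis by linarith
    qed
    then show ?thesis by blast
  qed
  have "\<exists>y. \<Inter>(range (\<lambda>n. DD n x)) = {y}" if "x \<in> space M" for x
    using that by (intro decreasing_closed_nest_sing DD_closed DD_nonempty DD_mono DD_small)
  then obtain s where s: "\<And>x. x \<in> space M \<Longrightarrow> \<Inter>(range (\<lambda>n. DD n x)) = {s x}"
    by metis
  have s_in: "s x \<in> DD n x" if "x \<in> space M" for x n
    using s[OF that] by blast
  \<comment> \<open>This writes preimages of closed sets as countable intersections of hit sets.
    From right to left, the sets \<open>DD n x \<inter> V\<close> are closed, nested and shrinking,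
    so they share a point, which can only be \<open>s x\<close>.\<close>
  have s_closed: "s x \<in> V \<longleftrightarrow> (\<forall>n. DD n x \<inter> V \<noteq> {})" if x: "x \<in> space M" and "closed V" for x V
  proof
    assume hits: "\<forall>n. DD n x \<inter> V \<noteq> {}"
    obtain y where "\<And>n. y \<in> DD n x \<inter> V"
    proof (rule decreasing_closed_nest[of "\<lambda>n. DD n x \<inter> V"])
      show "closed (DD n x \<inter> V)" for n
        using DD_closed[OF x] \<open>closed V\<close> by (rule closed_Int)
      show "DD n x \<inter> V \<subseteq> DD m x \<inter> V" if "m \<le> n" for m n
        using DD_mono[OF that] by blast
      show "\<exists>n. \<forall>y\<in>DD n x \<inter> V. \<forall>z\<in>DD n x \<inter> V. dist y z < r" if "0 < r" for r
        using DD_small[OF that, of x] by blast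
    qed (use hits in auto)
    then have "y \<in> {s x}" "y \<in> V"
      unfolding s[OF x, symmetric] by auto
    then show "s x \<in> V" by simp
  next
    assume "s x \<in> V"
    then show "\<forall>n. DD n x \<inter> V \<noteq> {}" using s_in[OF x] by auto
  qed
  show thesis
  proof
    show "s x \<in> D x" if "x \<in> space M" for x
      using s_in[OF that, of 0] by (simp add: DD_0)
    show "s \<in> borel_measurable M"
    proof (rule borel_measurableI)
      fix S :: "'b set"
      assume "open S"
      then have "{x \<in> space M. s x \<in> - S} = (\<Inter>n. {x \<in> space M. DD n x \<inter> - S \<noteq> {}})"
        using s_closed[of _ "- S"] by auto
      also have "\<dots> \<in> sets M"
        using \<open>open S\<close> by (intro sets.countable_INT) (auto intro!: DD_hit)
      finally have "space M - {x \<in> space M. s x \<in> - S} \<in> sets M" by blast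
      also have "space M - {x \<in> space M. s x \<in> - S} = s -` S \<inter> space M" by auto
      finally show "s -` S \<inter> space M \<in> sets M" .
    qed
  qed
qed

text \<open>Empty fibres are replaced by the whole space. The points where this happens form a
  measurable set, by \<open>hit\<close> for \<open>UNIV\<close>.\<close>

lemma measurable_selector:
  fixes D :: "'a \<Rightarrow> 'b::polish_space set"
  assumes closed: "\<And>x. x \<in> space M \<Longrightarrow> closed (D x)"
    and hit: "\<And>V. closed V \<Longrightarrow> {x \<in> space M. D x \<inter> V \<noteq> {}} \<in> sets M"
  obtains s where "s \<in> borel_measurable M"
    "\<And>x. x \<in> space M \<Longrightarrow> D x \<noteq> {} \<Longrightarrow> s x \<in> D x"
proof -
  define D' where "D' x = (if D x = {} then UNIV else D x)" for x
  obtain s where "s \<in> borel_measurable M" "\<And>x. x \<in> space M \<Longrightarrow> s x \<in> D' x"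
  proof (rule measurable_selector_total[of M D'])
    fix V :: "'b set"
    assume "closed V"
    \<comment> \<open>A fibre enlarged to \<open>UNIV\<close> meets every closed \<open>V\<close>
      except the empty one, hence the case distinction.\<close>
    have "{x \<in> space M. D' x \<inter> V \<noteq> {}} =
        (if V = {} then {} else {x \<in> space M. D x \<inter> V \<noteq> {}} \<union> (space M - {x \<in> space M. D x \<inter> UNIV \<noteq> {}}))"
      by (auto simp: D'_def)
    also have "\<dots> \<in> sets M"
      using hit[OF \<open>closed V\<close>] hit[OF closed_UNIV] by auto
    finally show "{x \<in> space M. D' x \<inter> V \<noteq> {}} \<in> sets M" .
  qed (auto simp: D'_def closed)
  then show thesis
    using that[of s] D'_def by metis
qed

section \<open>Compact projections of closed sets and almost everywhere selectors\<close>

lemma totally_bounded_compact_closure: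
  fixes T :: "'b::complete_space set"
  assumes "\<And>r. 0 < r \<Longrightarrow> \<exists>A. finite A \<and> T \<subseteq> (\<Union>a\<in>A. cball a r)"
  shows "compact (closure T)"
proof -
  have "\<exists>A. finite A \<and> closure T \<subseteq> (\<Union>a\<in>A. ball a r)" if "0 < r" for r
  proof -
    \<comment> \<open>A finite union of closed balls is closed and so covers the closure too;
      halving the radius leaves room to pass to open balls.\<close>
    from assms[of "r / 2"] that obtain A where A: "finite A" "T \<subseteq> (\<Union>a\<in>A. cball a (r / 2))"
      by auto
    then have "closure T \<subseteq> (\<Union>a\<in>A. cball a (r / 2))"
      by (intro closure_minimal) auto
    also have "\<dots> \<subseteq> (\<Union>a\<in>A. ball a r)"
      using that by fastforce
    finally show ?thesis
      using A by blast
  qed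
  then show ?thesis
    unfolding compact_eq_totally_bounded complete_eq_closed by simp
qed

text \<open>Compactness supplies a convergent subsequence of the second coordinates; for a general
  closed set in place of \<open>K\<close> the projection need not be closed.\<close>

lemma closed_compact_projection:
  fixes C :: "('a::metric_space \<times> 'b::metric_space) set"
  assumes "closed C" "compact K"
  shows "closed {x. \<exists>y\<in>K. (x, y) \<in> C}"
  unfolding closed_sequential_limits
proof (intro allI impI, elim conjE)
  fix xs x
  assume "\<forall>n. xs n \<in> {x. \<exists>y\<in>K. (x, y) \<in> C}" and x: "xs \<longlonglongrightarrow> x"
  then obtain ys where ys: "\<And>n. ys n \<in> K" "\<And>n. (xs n, ys n) \<in> C"
    by simp metis
  obtain y r where y: "y \<in> K" "strict_mono r" "(ys \<circ> r) \<longlonglongrightarrow> y"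
    using \<open>compact K\<close> ys(1) unfolding compact_eq_seq_compact_metric seq_compact_def by metis
  have "(\<lambda>n. ((xs \<circ> r) n, (ys \<circ> r) n)) \<longlonglongrightarrow> (x, y)"
    by (rule tendsto_Pair[OF LIMSEQ_subseq_LIMSEQ[OF x y(2)] y(3)])
  then have "(x, y) \<in> C"
    by (rule closed_sequentially[OF \<open>closed C\<close>, rotated]) (simp add: ys(2))
  with y show "x \<in> {x. \<exists>y\<in>K. (x, y) \<in> C}" by blast
qed

text \<open>The compact set is obtained by cutting down to finitely many small balls at each scale.
  Continuity of the outer measure along increasing sequences replaces the measurability of the
  projection, which may fail.\<close>

lemma compact_projection_measure:
  fixes C :: "('a::metric_space \<times> 'b::polish_space) set"
  assumes C: "closed C" and full: "\<And>x. \<exists>y. (x, y) \<in> C"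
    and "finite_measure M" and sets_M: "sets M = sets borel"
    and c: "c < emeasure M UNIV"
  obtains K where "compact K" "c \<le> emeasure M {x. \<exists>y\<in>K. (x, y) \<in> C}"
proof -
  interpret finite_measure M by fact
  have space_M[simp]: "space M = UNIV"
    using sets_eq_imp_space_eq[OF sets_M] by simp
  obtain e :: "nat \<Rightarrow> 'b" where e: "\<And>y r. 0 < r \<Longrightarrow> \<exists>i. dist (e i) y < r"
    using dense_sequence by blast
  define P where "P S = {x. \<exists>y\<in>S. (x, y) \<in> C}" for S
  have P_mono: "S \<subseteq> T \<Longrightarrow> P S \<subseteq> P T" for S T
    by (auto simp: P_def)
  define U where "U k n = (\<Union>i\<le>n. cball (e i) (1 / Suc k))" for k n :: nat
  \<comment> \<open>For fixed \<open>k\<close> the sets \<open>U k n\<close> increase to the whole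
    space, by density of \<open>e\<close>. Outer measure is continuous along increasing sequences of
    arbitrary sets, so some finite \<open>n\<close> already keeps the measure above
    \<open>c\<close>.\<close>
  have step: "\<exists>n. c < outer_measure_of M (P (S \<inter> U k n))" if "c < outer_measure_of M (P S)" for S k
  proof -
    have "S \<subseteq> (\<Union>n. S \<inter> U k n)"
    proof
      fix y assume "y \<in> S"
      obtain i where "dist (e i) y < 1 / Suc k" using e[of "1 / Suc k" y] by auto
      then have "y \<in> U k i" by (auto simp: U_def intro!: bexI[of _ i])
      with \<open>y \<in> S\<close> show "y \<in> (\<Union>n. S \<inter> U k n)" by blast
    qed
    then have "P S = (\<Union>n. P (S \<inter> U k n))"
      by (auto simp: P_def) blast
    moreover have "(SUP n. outer_measure_of M (P (S \<inter> U k n))) = outer_measure_of M (\<Union>n. P (S \<inter> U k n))"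
    proof (rule SUP_outer_measure_of_incseq)
      show "incseq (\<lambda>n. P (S \<inter> U k n))"
        by (intro monoI P_mono Int_mono) (auto simp: U_def intro: order_trans)
    qed simp
    ultimately have "c < (SUP n. outer_measure_of M (P (S \<inter> U k n)))"
      using that by simp
    then show ?thesis
      by (simp add: less_SUP_iff)
  qed
  \<comment> \<open>The choice is dependent because the number of balls at scale \<open>k\<close>
    depends on the set left over from the earlier scales.\<close>
  have "\<exists>S. \<forall>k. c < outer_measure_of M (P (S k)) \<and> (\<exists>n. S (Suc k) = S k \<inter> U k n)"
  proof (rule dependent_nat_choice)
    have "P UNIV = UNIV" using full by (auto simp: P_def)
    then show "\<exists>S. c < outer_measure_of M (P S)"
      using c by (intro exI[of _ UNIV]) (simp add: sets_M)
  qed (use step in blast)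
  then obtain S n where S: "\<And>k. c < outer_measure_of M (P (S k))" "\<And>k. S (Suc k) = S k \<inter> U k (n k)"
    by metis
  have S_mono: "i \<le> j \<Longrightarrow> S j \<subseteq> S i" for i j
    using lift_Suc_antimono_le[of S i j] by (simp add: S(2))
  \<comment> \<open>The intersection is taken over the sets \<open>U k (n k)\<close> and not over
    the \<open>S k\<close>: the choice does not record what \<open>S 0\<close> is, so the
    \<open>S k\<close> are not known to be closed.\<close>
  define K where "K = (\<Inter>k. U k (n k))"
  have cover: "\<exists>k. U k (n k) \<subseteq> (\<Union>a\<in>e ` {..n k}. cball a r)" if r: "0 < r" for r
  proof -
    obtain k where "1 / Suc k < r"
      using nat_approx_posE[OF r] by auto
    then have "cball a (1 / Suc k) \<subseteq> cball a r" for a :: 'b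
      by (intro subset_cball less_imp_le)
    then have "U k (n k) \<subseteq> (\<Union>a\<in>e ` {..n k}. cball a r)"
      unfolding U_def by blast
    then show ?thesis ..
  qed
  have "closed K"
    by (auto simp: K_def U_def)
  moreover have "compact (closure K)"
  proof (rule totally_bounded_compact_closure)
    fix r :: real assume "0 < r"
    then obtain k where "U k (n k) \<subseteq> (\<Union>a\<in>e ` {..n k}. cball a r)" using cover by blast
    then show "\<exists>A. finite A \<and> K \<subseteq> (\<Union>a\<in>A. cball a r)"
      by (intro exI[of _ "e ` {..n k}"]) (auto simp: K_def)
  qed
  ultimately have "compact K" by simp
  \<comment> \<open>A point \<open>x\<close> in all closures is a limit of first coordinates of
    points of \<open>C\<close> whose second coordinates run through the shrinking sets
    \<open>S k\<close>. Those form a relatively compact sequence; a limit \<open>y\<close> lies in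
    every \<open>U k (n k)\<close>, and \<open>(x, y)\<close> lies in \<open>C\<close> as
    \<open>C\<close> is closed.\<close>
  have "(\<Inter>k. closure (P (S k))) \<subseteq> P K"
  proof
    fix x assume x: "x \<in> (\<Inter>k. closure (P (S k)))"
    have "\<exists>x' y. y \<in> S k \<and> (x', y) \<in> C \<and> dist x' x < 1 / Suc k" for k
    proof -
      have "x \<in> closure (P (S k))" using x by blast
      then obtain x' where "x' \<in> P (S k)" "dist x' x < 1 / Suc k"
        unfolding closure_approachable using of_nat_0_less_iff zero_less_divide_1_iff by blast
      then show ?thesis by (auto simp: P_def)
    qed
    then obtain xs ys where xy: "\<And>k. ys k \<in> S k" "\<And>k. (xs k, ys k) \<in> C" "\<And>k. dist (xs k) x < 1 / Suc k"
      by metis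
    have "xs \<longlonglongrightarrow> x"
      unfolding tendsto_dist_iff[of xs]
      by (rule tendsto_sandwich[OF _ _ tendsto_const LIMSEQ_inverse_real_of_nat])
         (use xy(3) in \<open>auto intro!: always_eventually simp: inverse_eq_divide less_imp_le\<close>)
    have tail: "ys j \<in> U k (n k)" if "k < j" for j k
      using xy(1)[of j] S_mono[of "Suc k" j] that by (auto simp: S(2))
    have "compact (closure (range ys))"
    proof (rule totally_bounded_compact_closure)
      fix r :: real assume "0 < r"
      then obtain k where k: "U k (n k) \<subseteq> (\<Union>a\<in>e ` {..n k}. cball a r)" using cover by blast
      \<comment> \<open>The terms up to index \<open>k\<close> serve as their own centres; all later
        ones lie in \<open>U k (n k)\<close>.\<close>
      have "range ys \<subseteq> (\<Union>a\<in>ys ` {..k} \<union> e ` {..n k}. cball a r)"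
      proof safe
        fix j
        show "ys j \<in> (\<Union>a\<in>ys ` {..k} \<union> e ` {..n k}. cball a r)"
        proof (cases "j \<le> k")
          case True
          then show ?thesis using \<open>0 < r\<close> by (auto intro!: bexI[of _ j])
        next
          case False
          then show ?thesis using tail[of k j] k by auto
        qed
      qed
      then show "\<exists>A. finite A \<and> range ys \<subseteq> (\<Union>a\<in>A. cball a r)"
        by (meson finite_UnI finite_atMost finite_imageI)
    qed
    moreover have "\<forall>k. ys k \<in> closure (range ys)"
      using closure_subset[of "range ys"] by auto
    ultimately obtain y r where y: "strict_mono r" "(ys \<circ> r) \<longlonglongrightarrow> y"
      unfolding compact_eq_seq_compact_metric seq_compact_def by blast
    have "(\<lambda>n. ((xs \<circ> r) n, (ys \<circ> r) n)) \<longlonglongrightarrow> (x, y)"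
      by (rule tendsto_Pair[OF LIMSEQ_subseq_LIMSEQ[OF \<open>xs \<longlonglongrightarrow> x\<close> y(1)] y(2)])
    then have "(x, y) \<in> C"
      by (rule closed_sequentially[OF C, rotated]) (simp add: xy(2))
    moreover have "y \<in> U k (n k)" for k
    proof (rule Lim_in_closed_set[OF _ _ _ y(2)])
      show "\<forall>\<^sub>F j in sequentially. (ys \<circ> r) j \<in> U k (n k)"
        using eventually_gt_at_top[of k]
        by eventually_elim (use seq_suble[OF y(1)] tail in \<open>auto intro: less_le_trans\<close>)
    qed (auto simp: U_def)
    ultimately show "x \<in> P K" by (auto simp: P_def K_def)
  qed
  moreover have "P K \<in> sets M"
    unfolding sets_M P_def using closed_compact_projection[OF C \<open>compact K\<close>] by simp
  ultimately have "emeasure M (\<Inter>k. closure (P (S k))) \<le> emeasure M (P K)"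
    by (rule emeasure_mono)
  \<comment> \<open>The closures are measurable and decreasing, and \<open>M\<close> is finite, so
    continuity from above applies to them, whereas it could fail for the outer measures of the
    projections.\<close>
  moreover have "c \<le> emeasure M (\<Inter>k. closure (P (S k)))"
  proof -
    have "c \<le> emeasure M (closure (P (S k)))" for k
    proof -
      have "c \<le> outer_measure_of M (P (S k))" using S(1)[of k] by simp
      also have "\<dots> \<le> outer_measure_of M (closure (P (S k)))"
        by (intro outer_measure_of_mono closure_subset)
      finally show ?thesis by (simp add: sets_M)
    qed
    then have "c \<le> (INF k. emeasure M (closure (P (S k))))"
      by (rule INF_greatest)
    also have "\<dots> = emeasure M (\<Inter>k. closure (P (S k)))"
      by (intro INF_emeasure_decseq)
         (auto simp: sets_M decseq_def intro!: closure_mono P_mono dest: S_mono)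
    finally show ?thesis .
  qed
  ultimately show thesis
    using that[OF \<open>compact K\<close>] by (simp add: P_def)
qed

text \<open>Compact sets \<open>K j\<close> whose projections have measure at least
  \<open>1 - 1 / Suc j\<close> make the fibres compact, and there the exact selection theorem
  applies. The selectors are glued along the first \<open>j\<close> that works, and the points with
  no such \<open>j\<close> form a null set.\<close>

lemma AE_measurable_selector:
  fixes C :: "('a::metric_space \<times> 'b::polish_space) set"
  assumes C: "closed C" and full: "\<And>x. \<exists>y. (x, y) \<in> C"
    and "prob_space M" and sets_M: "sets M = sets borel"
  obtains s where "s \<in> borel_measurable M" "AE x in M. (x, s x) \<in> C"
proof -
  interpret prob_space M by fact
  have space_M[simp]: "space M = UNIV"
    using sets_eq_imp_space_eq[OF sets_M] by simp
  have "\<exists>K. \<forall>j. compact (K j) \<and> ennreal (1 - 1 / Suc j) \<le> emeasure M {x. \<exists>y\<in>K j. (x, y) \<in> C}"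
  proof (intro choice allI)
    fix j
    have "ennreal (1 - 1 / Suc j) < emeasure M UNIV"
      using emeasure_space_1 by (simp add: ennreal_less_one_iff)
    then obtain K where "compact K" "ennreal (1 - 1 / Suc j) \<le> emeasure M {x. \<exists>y\<in>K. (x, y) \<in> C}"
      by (rule compact_projection_measure[OF C full finite_measure_axioms sets_M])
    then show "\<exists>K. compact K \<and> ennreal (1 - 1 / Suc j) \<le> emeasure M {x. \<exists>y\<in>K. (x, y) \<in> C}"
      by blast
  qed
  then obtain K where K: "\<And>j. compact (K j)"
      "\<And>j. ennreal (1 - 1 / Suc j) \<le> emeasure M {x. \<exists>y\<in>K j. (x, y) \<in> C}"
    by blast
  define D where "D j x = {y \<in> K j. (x, y) \<in> C}" for j x
  define E where "E j = {x. D j x \<noteq> {}}" for j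
  \<comment> \<open>Intersecting \<open>K j\<close> with a closed set keeps it compact, so each hit
    set is again a closed projection.\<close>
  have hit: "{x \<in> space M. D j x \<inter> V \<noteq> {}} \<in> sets M" if "closed V" for j V
  proof -
    have "{x \<in> space M. D j x \<inter> V \<noteq> {}} = {x. \<exists>y\<in>K j \<inter> V. (x, y) \<in> C}"
      by (auto simp: D_def)
    also have "closed \<dots>"
      using C K(1) that by (intro closed_compact_projection compact_Int_closed)
    finally show ?thesis by (simp add: sets_M)
  qed
  have "closed (D j x)" for j x
  proof -
    have "D j x = K j \<inter> Pair x -` C" by (auto simp: D_def)
    moreover have "closed (Pair x -` C)"
      by (intro closed_vimage C continuous_intros)
    ultimately show ?thesis
      using K(1) by (simp add: closed_Int compact_imp_closed)
  qed
  then have "\<exists>s. \<forall>j. s j \<in> borel_measurable M \<and> (\<forall>x. D j x \<noteq> {} \<longrightarrow> s j x \<in> D j x)"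
    by (intro choice allI) (rule measurable_selector[of M "D _"], auto intro: hit[simplified])
  then obtain s where s: "\<And>j. s j \<in> borel_measurable M" "\<And>j x. D j x \<noteq> {} \<Longrightarrow> s j x \<in> D j x"
    by blast
  have E: "E j \<in> sets M" for j
    using hit[of UNIV j] by (simp add: E_def)
  \<comment> \<open>Outside all \<open>E j\<close> this index is unspecified, which affects only a
    null set.\<close>
  define i where "i x = (LEAST j. x \<in> E j)" for x
  show thesis
  proof
    have "i \<in> measurable M (count_space UNIV)"
      unfolding i_def using E by (intro measurable_Least) (simp add: pred_def)
    then show "(\<lambda>x. s (i x) x) \<in> borel_measurable M"
      by (rule measurable_compose_countable[OF s(1)])
    have UE: "(\<Union>j. E j) \<in> events" using E by auto
    have "1 - 1 / Suc j \<le> prob (\<Union>j. E j)" for j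
    proof -
      have "ennreal (1 - 1 / Suc j) \<le> emeasure M (E j)"
        using K(2)[of j] by (simp add: E_def D_def Bex_def)
      also have "\<dots> \<le> emeasure M (\<Union>j. E j)"
        using UE by (intro emeasure_mono) auto
      finally show ?thesis by (simp add: emeasure_eq_measure)
    qed
    moreover have "(\<lambda>j. 1 - 1 / real (Suc j)) \<longlonglongrightarrow> 1 - 0"
      by (rule tendsto_diff[OF tendsto_const LIMSEQ_Suc[OF lim_1_over_n]])
    ultimately have "1 - 0 \<le> prob (\<Union>j. E j)"
      by (intro LIMSEQ_le_const2) auto
    then have "prob (\<Union>j. E j) = 1"
      using prob_le_1[of "\<Union>j. E j"] by linarith
    then have "AE x in M. x \<in> (\<Union>j. E j)"
      by (simp only: AE_in_set_eq_1[OF UE])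
    then show "AE x in M. (x, s (i x) x) \<in> C"
    proof eventually_elim
      case (elim x)
      then have "x \<in> E (i x)" unfolding i_def by (auto intro: LeastI)
      then show ?case using s(2)[of "i x" x] by (simp add: E_def D_def)
    qed
  qed
qed

subsection \<open>Gradients in Hilbert space\<close>

text \<open>Variational proof: the representing vector is the minimizer of
  \<open>J x = inner x x - 2 * \<phi> x\<close>. Minimizing sequences are Cauchy by the
  parallelogram law, and the first-order condition at the limit is the representation.\<close>

lemma Riesz_representation:
  fixes \<phi> :: "'h::{real_inner, banach} \<Rightarrow> real"
  assumes "bounded_linear \<phi>"
  shows "\<exists>d. \<forall>v. \<phi> v = inner v d"
proof -
  interpret bounded_linear \<phi> by fact
  obtain B where B: "\<And>x. norm (\<phi> x) \<le> norm x * B"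
    using bounded by blast
  define J where "J x = inner x x - 2 * \<phi> x" for x
  have "- B\<^sup>2 \<le> J x" for x
  proof -
    have "0 \<le> (norm x - B)\<^sup>2" by simp
    then show ?thesis
      using B[of x] by (simp add: J_def dot_square_norm power2_diff algebra_simps)
  qed
  then have bdd: "bdd_below (range J)" by (intro bdd_belowI[of _ "- B\<^sup>2"]) auto
  define I where "I = Inf (range J)"
  have I_le: "I \<le> J x" for x
    unfolding I_def by (rule cINF_lower[OF bdd]) simp
  have "\<exists>x. J x < I + 1 / Suc n" for n
    using cInf_lessD[of "range J" "I + 1 / Suc n"] by (auto simp: I_def)
  then obtain xs where xs: "\<And>n. J (xs n) < I + 1 / Suc n"
    by metis
  \<comment> \<open>The linear terms cancel, so the parallelogram law for the norm carries over to
    \<open>J\<close>.\<close>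
  have parallelogram: "(norm (x - y))\<^sup>2 = 2 * J x + 2 * J y - 4 * J ((1 / 2) *\<^sub>R (x + y))" for x y
    by (simp add: J_def power2_norm_eq_inner inner_simps scaleR add algebra_simps inner_commute[of y x])
  have "Cauchy xs"
  proof (rule metric_CauchyI)
    fix r :: real
    assume "0 < r"
    \<comment> \<open>If two values of \<open>J\<close> lie within \<open>r\<^sup>2 / 4\<close> of
      the infimum, the identity bounds the squared distance by
      \<open>2 * r\<^sup>2 / 4 + 2 * r\<^sup>2 / 4 = r\<^sup>2\<close>.\<close>
    then obtain N where N: "1 / Suc N < r\<^sup>2 / 4"
      using nat_approx_posE[of "r\<^sup>2 / 4"] by auto
    have small: "J (xs n) < I + r\<^sup>2 / 4" if "N \<le> n" for n
    proof -
      have "1 / real (Suc n) \<le> 1 / Suc N"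
        using that by (simp add: frac_le)
      with xs[of n] N show ?thesis by linarith
    qed
    have "dist (xs i) (xs j) < r" if "N \<le> i" "N \<le> j" for i j
    proof -
      have "(norm (xs i - xs j))\<^sup>2 < r\<^sup>2"
        unfolding parallelogram using small[OF that(1)] small[OF that(2)] I_le[of "(1 / 2) *\<^sub>R (xs i + xs j)"]
        by linarith
      then show ?thesis
        using \<open>0 < r\<close> by (simp add: dist_norm power2_less_imp_less)
    qed
    then show "\<exists>N. \<forall>i\<ge>N. \<forall>j\<ge>N. dist (xs i) (xs j) < r" by blast
  qed
  then obtain d where d: "xs \<longlonglongrightarrow> d"
    using Cauchy_convergent convergent_def by blast
  have "(\<lambda>n. J (xs n)) \<longlonglongrightarrow> J d"
    unfolding J_def by (intro tendsto_intros tendsto d)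
  moreover have "(\<lambda>n. I + 1 / real (Suc n)) \<longlonglongrightarrow> I + 0"
    by (rule tendsto_add[OF tendsto_const LIMSEQ_Suc[OF lim_1_over_n]])
  ultimately have "J d \<le> I + 0"
    by (rule LIMSEQ_le) (use xs in \<open>auto intro!: exI[of _ 0] less_imp_le\<close>)
  then have J_min: "J d \<le> J x" for x
    using I_le[of x] by simp
  have "\<phi> v = inner v d" for v
  proof (cases "v = 0")
    case False
    define a b where "a = inner v d - \<phi> v" and "b = inner v v"
    have "0 < b" using False by (simp add: b_def)
    have "J (d + t *\<^sub>R v) = J d + 2 * t * a + t\<^sup>2 * b" for t
      by (simp add: J_def a_def b_def inner_simps scaleR add algebra_simps power2_eq_square inner_commute[of d v])
    \<comment> \<open>The parameter \<open>- a / b\<close> minimizes the quadratic in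
      \<open>t\<close> and lowers \<open>J d\<close> by \<open>a\<^sup>2 / b\<close>.\<close>
    from this[of "- a / b"] J_min[of "d + (- a / b) *\<^sub>R v"] have "a\<^sup>2 / b \<le> 0"
      using \<open>0 < b\<close> by (simp add: power2_eq_square)
    then have "a = 0"
      using \<open>0 < b\<close> by (simp add: divide_le_0_iff)
    then show ?thesis by (simp add: a_def)
  qed (simp add: zero)
  then show ?thesis by blast
qed

text \<open>The Frechet derivative is a bounded functional, so Riesz gives a representing vector;
  its uniqueness is what the definite description in \<open>gradient\<close> requires.\<close>

lemma GDERIV_gradient:
  fixes f :: "'h::{real_inner, banach} \<Rightarrow> real"
  assumes "f differentiable (at x)"
  shows "GDERIV f x :> gradient f x"
proof -
  obtain D where D: "(f has_derivative D) (at x)"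
    using assms by (auto simp: differentiable_def)
  then obtain d where "D = (\<lambda>v. inner v d)"
    using Riesz_representation[OF has_derivative_bounded_linear[OF D]] by auto
  with D have "GDERIV f x :> d"
    by (simp add: gderiv_def)
  moreover have "d' = d" if "GDERIV f x :> d'" for d'
    using has_derivative_unique[OF that[unfolded gderiv_def] \<open>GDERIV f x :> d\<close>[unfolded gderiv_def]]
    by (metis vector_eq_rdot inner_commute)
  ultimately show ?thesis
    unfolding gradient_def by (rule theI)
qed

lemma GDERIV_line:
  assumes "GDERIV f x :> D"
  shows "((\<lambda>t. f (x + t *\<^sub>R d)) has_real_derivative inner d D) (at 0)"
proof -
  have "((\<lambda>t. x + t *\<^sub>R d) has_derivative (\<lambda>t. t *\<^sub>R d)) (at 0)"
    by (auto intro!: derivative_eq_intros)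
  moreover have "(f has_derivative (\<lambda>h. inner h D)) (at (x + 0 *\<^sub>R d))"
    using assms by (simp add: gderiv_def)
  ultimately have "((\<lambda>t. f (x + t *\<^sub>R d)) has_derivative (\<lambda>t. inner (t *\<^sub>R d) D)) (at 0)"
    by (rule has_derivative_compose)
  then show ?thesis
    unfolding has_field_derivative_def by (rule has_derivative_eq_rhs) (auto simp: fun_eq_iff)
qed

text \<open>Otherwise \<open>q\<close>, the restriction of \<open>f\<close> to the segment minus the
  slope of its chord, would increase strictly to the right of 0, while convexity gives
  \<open>q h \<le> q 0\<close>.\<close>

lemma convex_GDERIV_above_tangent:
  assumes "convex_on UNIV f" and D: "GDERIV f x :> D"
  shows "f x + inner (y - x) D \<le> f y"
proof (rule ccontr)
  assume "\<not> ?thesis"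
  then have pos: "0 < inner (y - x) D - (f y - f x)" by simp
  define q where "q t = f (x + t *\<^sub>R (y - x)) - t * (f y - f x)" for t
  have "(q has_real_derivative inner (y - x) D - (f y - f x)) (at 0)"
    unfolding q_def using GDERIV_line[OF D] by (auto intro!: derivative_eq_intros)
  from has_real_derivative_pos_inc_right[OF this pos] obtain d where "0 < d" and
    d: "\<And>h. 0 < h \<Longrightarrow> h < d \<Longrightarrow> q 0 < q h"
    by auto
  define h where "h = min (d / 2) 1"
  have h: "0 < h" "h < d" "h \<le> 1" using \<open>0 < d\<close> by (auto simp: h_def)
  have "f ((1 - h) *\<^sub>R x + h *\<^sub>R y) \<le> (1 - h) * f x + h * f y"
    using h by (intro convex_onD[OF assms(1)]) auto
  also have "(1 - h) *\<^sub>R x + h *\<^sub>R y = x + h *\<^sub>R (y - x)"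
    by (simp add: algebra_simps)
  finally show False
    using d[OF h(1,2)] by (simp add: q_def algebra_simps)
qed

lemma GDERIV_nonneg_if_min_on_segment:
  assumes D: "GDERIV f x :> D" and min: "\<And>t. 0 \<le> t \<Longrightarrow> t \<le> 1 \<Longrightarrow> f x \<le> f (x + t *\<^sub>R d)"
  shows "0 \<le> inner d D"
proof (rule ccontr)
  assume "\<not> ?thesis"
  then have "inner d D < 0" by simp
  from has_real_derivative_neg_dec_right[OF GDERIV_line[OF D] this]
  obtain e where "0 < e" and e: "\<And>h. 0 < h \<Longrightarrow> h < e \<Longrightarrow> f (x + h *\<^sub>R d) < f x"
    by auto
  from e[of "min (e / 2) 1"] min[of "min (e / 2) 1"] \<open>0 < e\<close> show False by (auto simp: min_less_iff_disj)
qed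

subsection \<open>Measures with prescribed marginal\<close>

lemma marginal_probsD:
  assumes "\<mu> \<in> marginal_probs F m"
  shows "prob_space \<mu>" "sets \<mu> = sets (restrict_space borel (graph_of F))" "space \<mu> = graph_of F"
    "distr \<mu> borel fst = m"
proof -
  show "prob_space \<mu>" "distr \<mu> borel fst = m" and sets: "sets \<mu> = sets (restrict_space borel (graph_of F))"
    using assms by (simp_all add: marginal_probs_def space_prob_algebra)
  show "space \<mu> = graph_of F"
    using sets_eq_imp_space_eq[OF sets] by (simp add: space_restrict_space)
qed

lemma measurable_fst_graph [measurable]:
  "fst \<in> measurable (restrict_space (borel :: ('a::topological_space \<times> 'b::topological_space) measure) A) borel"
  by (intro measurable_restrict_space1 borel_measurable_continuous_onI continuous_on_fst continuous_on_id)

lemma measurable_marginal_probs: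
  assumes "\<mu> \<in> marginal_probs F m"
  shows "measurable \<mu> N = measurable (restrict_space borel (graph_of F)) N"
  by (rule measurable_cong_sets) (simp_all add: marginal_probsD[OF assms])

lemma marginal_probs_integrable:
  fixes k :: "'a::topological_space \<times> 'b::topological_space \<Rightarrow> 'h::{banach, second_countable_topology}"
  assumes "\<mu> \<in> marginal_probs F m" "k \<in> borel_measurable (restrict_space borel (graph_of F))"
    and "bounded (k ` graph_of F)"
  shows "integrable \<mu> k"
proof -
  interpret prob_space \<mu> by (rule marginal_probsD[OF assms(1)])
  obtain B where "\<And>z. z \<in> graph_of F \<Longrightarrow> norm (k z) \<le> B"
    using assms(3) by (auto simp: bounded_iff)
  then show ?thesis
    by (intro integrable_const_bound[where B=B])
       (auto simp: measurable_marginal_probs[OF assms(1)] assms(2) marginal_probsD[OF assms(1)])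
qed

text \<open>The mixture is the monadic bind of a Bernoulli measure with the two given measures.
  Integrands are real because the integral formula comes from nonnegative integrals; vector-valued
  ones are recovered through inner products.\<close>

lemma marginal_probs_mixture:
  fixes F :: "'a::topological_space \<Rightarrow> 'b::topological_space set"
  assumes \<mu>: "\<mu> \<in> marginal_probs F m" and \<nu>: "\<nu> \<in> marginal_probs F m" and t: "0 \<le> t" "t \<le> 1"
  obtains \<rho> where "\<rho> \<in> marginal_probs F m"
    "\<And>k :: 'a \<times> 'b \<Rightarrow> real. k \<in> borel_measurable (restrict_space borel (graph_of F)) \<Longrightarrow>
       bounded (k ` graph_of F) \<Longrightarrow> (\<integral>z. k z \<partial>\<rho>) = t * (\<integral>z. k z \<partial>\<mu>) + (1 - t) * (\<integral>z. k z \<partial>\<nu>)"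
proof
  let ?N = "restrict_space borel (graph_of F) :: ('a \<times> 'b) measure"
  let ?p = "measure_pmf (bernoulli_pmf t)"
  define K where "K b = (if b then \<mu> else \<nu>)" for b
  have K_marginal: "K b \<in> marginal_probs F m" for b
    using \<mu> \<nu> by (simp add: K_def)
  have p: "?p \<in> space (prob_algebra (count_space UNIV))"
    by (simp add: space_prob_algebra measure_pmf.prob_space_axioms)
  have K: "K \<in> measurable (count_space UNIV) (prob_algebra ?N)"
    using K_marginal by (auto simp: marginal_probs_def)
  have "sets (?p \<bind> K) = sets ?N" "prob_space (?p \<bind> K)"
    using sets_bind'[OF p K] prob_space_bind'[OF p K] by auto
  moreover have K': "K \<in> measurable ?p (subprob_algebra ?N)"
    using measurable_prob_algebraD[OF K] by simp
  have "prob_space m"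
    using prob_space.prob_space_distr[OF marginal_probsD(1)[OF \<mu>], of fst borel] marginal_probsD(4)[OF \<mu>]
    by (simp add: measurable_marginal_probs[OF \<mu>])
  \<comment> \<open>Both measures have first marginal \<open>m\<close>, so the push-forward is the
    bind of a constant kernel.\<close>
  then have "distr (?p \<bind> K) borel fst = m"
    by (simp add: distr_bind[OF K'] marginal_probsD(4)[OF K_marginal] bind_const'
          measure_pmf.prob_space_axioms prob_space_imp_subprob_space)
  ultimately show \<rho>: "?p \<bind> K \<in> marginal_probs F m"
    by (simp add: marginal_probs_def space_prob_algebra)
  fix k :: "'a \<times> 'b \<Rightarrow> real"
  assume k: "k \<in> borel_measurable ?N" and bdd: "bounded (k ` graph_of F)"
  obtain B where B: "\<And>z. z \<in> graph_of F \<Longrightarrow> \<bar>k z\<bar> \<le> B"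
    using bdd by (auto simp: bounded_iff)
  \<comment> \<open>Adding the bound \<open>B\<close> makes the integrand nonnegative, as the
    integral formula for bind requires.\<close>
  have shift: "(\<integral>\<^sup>+ z. ennreal (k z + B) \<partial>\<sigma>) = ennreal ((\<integral>z. k z \<partial>\<sigma>) + B)"
    and shift_nonneg: "0 \<le> (\<integral>z. k z \<partial>\<sigma>) + B" if \<sigma>: "\<sigma> \<in> marginal_probs F m" for \<sigma>
  proof -
    interpret prob_space \<sigma> by (rule marginal_probsD[OF \<sigma>])
    have int: "integrable \<sigma> k" by (rule marginal_probs_integrable[OF \<sigma> k bdd])
    have nonneg: "0 \<le> k z + B" if "z \<in> space \<sigma>" for z
      using B[of z] that marginal_probsD(3)[OF \<sigma>] by auto
    have eq: "(\<integral>z. k z + B \<partial>\<sigma>) = (\<integral>z. k z \<partial>\<sigma>) + B"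
      using int by (simp add: prob_space)
    show "(\<integral>\<^sup>+ z. ennreal (k z + B) \<partial>\<sigma>) = ennreal ((\<integral>z. k z \<partial>\<sigma>) + B)"
      using int nonneg by (subst nn_integral_eq_integral) (auto simp: eq)
    show "0 \<le> (\<integral>z. k z \<partial>\<sigma>) + B"
      unfolding eq[symmetric] using nonneg by (intro Bochner_Integration.integral_nonneg_AE AE_I2)
  qed
  have "ennreal ((\<integral>z. k z \<partial>(?p \<bind> K)) + B) = (\<integral>\<^sup>+ z. ennreal (k z + B) \<partial>(?p \<bind> K))"
    by (rule shift[OF \<rho>, symmetric])
  also have "\<dots> = (\<integral>\<^sup>+ b. \<integral>\<^sup>+ z. ennreal (k z + B) \<partial>K b \<partial>?p)"
    by (rule nn_integral_bind[OF _ K']) (use k in measurable)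
  also have "\<dots> = ennreal ((\<integral>z. k z \<partial>\<mu>) + B) * ennreal t + ennreal ((\<integral>z. k z \<partial>\<nu>) + B) * ennreal (1 - t)"
    using t by (simp add: shift[OF K_marginal]) (simp add: K_def)
  also have "\<dots> = ennreal (((\<integral>z. k z \<partial>\<mu>) + B) * t + ((\<integral>z. k z \<partial>\<nu>) + B) * (1 - t))"
    using t shift_nonneg[OF \<mu>] shift_nonneg[OF \<nu>] by (simp only: ennreal_plus ennreal_mult mult_nonneg_nonneg diff_ge_0_iff_ge)
  finally have "(\<integral>z. k z \<partial>(?p \<bind> K)) + B = ((\<integral>z. k z \<partial>\<mu>) + B) * t + ((\<integral>z. k z \<partial>\<nu>) + B) * (1 - t)"
    using t shift_nonneg[OF \<mu>] shift_nonneg[OF \<nu>] shift_nonneg[OF \<rho>] by (subst (asm) ennreal_inj) auto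
  then show "(\<integral>z. k z \<partial>(?p \<bind> K)) = t * (\<integral>z. k z \<partial>\<mu>) + (1 - t) * (\<integral>z. k z \<partial>\<nu>)"
    by (simp add: algebra_simps)
qed

text \<open>Mixing realizes every point of the segment between two attainable integrals, so a
  minimum of \<open>f\<close> forces a nonnegative directional derivative. The converse is the
  tangent inequality.\<close>

lemma marginal_probs_minimizer_iff_linear:
  fixes F :: "'a::topological_space \<Rightarrow> 'b::topological_space set"
    and g :: "'a \<times> 'b \<Rightarrow> 'h::{real_inner, banach, second_countable_topology}"
  assumes g: "g \<in> borel_measurable (restrict_space borel (graph_of F))" "bounded (g ` graph_of F)"
    and f: "convex_on UNIV f" and D: "GDERIV f (\<integral>z. g z \<partial>\<mu>0) :> D"
    and \<mu>0: "\<mu>0 \<in> marginal_probs F m"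
  shows "(\<forall>\<mu>\<in>marginal_probs F m. f (\<integral>z. g z \<partial>\<mu>0) \<le> f (\<integral>z. g z \<partial>\<mu>)) \<longleftrightarrow>
    (\<forall>\<mu>\<in>marginal_probs F m. (\<integral>z. inner D (g z) \<partial>\<mu>0) \<le> (\<integral>z. inner D (g z) \<partial>\<mu>))"
proof -
  have int: "integrable \<mu> g" if "\<mu> \<in> marginal_probs F m" for \<mu>
    using that g by (rule marginal_probs_integrable)
  have inner_int: "(\<integral>z. inner w (g z) \<partial>\<mu>) = inner w (\<integral>z. g z \<partial>\<mu>)" if "\<mu> \<in> marginal_probs F m" for w \<mu>
    using int[OF that] by simp
  have linear_iff: "(\<integral>z. inner D (g z) \<partial>\<mu>0) \<le> (\<integral>z. inner D (g z) \<partial>\<mu>) \<longleftrightarrow>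
      0 \<le> inner ((\<integral>z. g z \<partial>\<mu>) - (\<integral>z. g z \<partial>\<mu>0)) D" if "\<mu> \<in> marginal_probs F m" for \<mu>
    by (simp add: inner_int[OF that] inner_int[OF \<mu>0] inner_commute[of _ D] inner_diff_right)
  show ?thesis
  proof
    assume min: "\<forall>\<mu>\<in>marginal_probs F m. f (\<integral>z. g z \<partial>\<mu>0) \<le> f (\<integral>z. g z \<partial>\<mu>)"
    show "\<forall>\<mu>\<in>marginal_probs F m. (\<integral>z. inner D (g z) \<partial>\<mu>0) \<le> (\<integral>z. inner D (g z) \<partial>\<mu>)"
    proof
      fix \<mu> assume \<mu>: "\<mu> \<in> marginal_probs F m"
      define d where "d = (\<integral>z. g z \<partial>\<mu>) - (\<integral>z. g z \<partial>\<mu>0)"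
      have "0 \<le> inner d D"
      proof (rule GDERIV_nonneg_if_min_on_segment[OF D])
        fix t :: real
        assume t: "0 \<le> t" "t \<le> 1"
        obtain \<rho> where \<rho>: "\<rho> \<in> marginal_probs F m" and
          mix: "\<And>k :: 'a \<times> 'b \<Rightarrow> real. k \<in> borel_measurable (restrict_space borel (graph_of F)) \<Longrightarrow>
            bounded (k ` graph_of F) \<Longrightarrow> (\<integral>z. k z \<partial>\<rho>) = t * (\<integral>z. k z \<partial>\<mu>) + (1 - t) * (\<integral>z. k z \<partial>\<mu>0)"
          using marginal_probs_mixture[OF \<mu> \<mu>0 t] by blast
        \<comment> \<open>Testing against every \<open>w\<close> turns the real mixture formula into
          an identity of Hilbert space integrals.\<close>
        have "inner w (\<integral>z. g z \<partial>\<rho>) = inner w ((\<integral>z. g z \<partial>\<mu>0) + t *\<^sub>R d)" for w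
        proof -
          have "bounded ((\<lambda>z. inner w (g z)) ` graph_of F)"
            using bounded_linear_image[OF g(2) bounded_linear_inner_right[of w]] by (simp add: image_image)
          then have "(\<integral>z. inner w (g z) \<partial>\<rho>) = t * (\<integral>z. inner w (g z) \<partial>\<mu>) + (1 - t) * (\<integral>z. inner w (g z) \<partial>\<mu>0)"
            using g(1) by (intro mix) auto
          then show ?thesis
            by (simp add: inner_int \<mu> \<mu>0 \<rho> d_def inner_simps algebra_simps)
        qed
        then have "(\<integral>z. g z \<partial>\<rho>) = (\<integral>z. g z \<partial>\<mu>0) + t *\<^sub>R d"
          by (metis vector_eq_ldot)
        then show "f (\<integral>z. g z \<partial>\<mu>0) \<le> f ((\<integral>z. g z \<partial>\<mu>0) + t *\<^sub>R d)"
          using min \<rho> by metis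
      qed
      then show "(\<integral>z. inner D (g z) \<partial>\<mu>0) \<le> (\<integral>z. inner D (g z) \<partial>\<mu>)"
        by (simp add: linear_iff[OF \<mu>] d_def)
    qed
  next
    assume "\<forall>\<mu>\<in>marginal_probs F m. (\<integral>z. inner D (g z) \<partial>\<mu>0) \<le> (\<integral>z. inner D (g z) \<partial>\<mu>)"
    then show "\<forall>\<mu>\<in>marginal_probs F m. f (\<integral>z. g z \<partial>\<mu>0) \<le> f (\<integral>z. g z \<partial>\<mu>)"
      using convex_GDERIV_above_tangent[OF f D] linear_iff by (smt (verit, best))
  qed
qed

subsection \<open>Supports and best responses\<close>

text \<open>The open complement of \<open>S\<close> is null exactly when it misses the support:
  points outside the support are covered by the null members of a countable basis, whose union is
  null.\<close>

lemma measure_support_subset_iff: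
  fixes M :: "'b::second_countable_topology measure"
  assumes sets_M: "sets M = sets borel" and "closed S"
  shows "measure_support M \<subseteq> S \<longleftrightarrow> (AE y in M. y \<in> S)"
proof
  assume "AE y in M. y \<in> S"
  moreover have "- S \<in> sets M"
    using \<open>closed S\<close> by (simp add: sets_M)
  ultimately have "emeasure M (- S) = 0"
    by (subst (asm) AE_iff_measurable[where N="- S"]) (use sets_eq_imp_space_eq[OF sets_M] in auto)
  then show "measure_support M \<subseteq> S"
    using \<open>closed S\<close> by (fastforce simp: measure_support_def)
next
  assume subset: "measure_support M \<subseteq> S"
  obtain B :: "'b set set" where B: "countable B" "topological_basis B"
    using ex_countable_basis by blast
  have "AE y in M. \<forall>U\<in>{U \<in> B. emeasure M U = 0}. y \<notin> U"
  proof (subst AE_ball_countable)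
    show "\<forall>U\<in>{U \<in> B. emeasure M U = 0}. AE y in M. y \<notin> U"
      using topological_basis_open[OF B(2)] by (auto intro!: AE_not_in simp: null_sets_def sets_M)
  qed (use B in \<open>auto intro: countable_subset[of _ B]\<close>)
  then show "AE y in M. y \<in> S"
  proof eventually_elim
    case (elim y)
    have "y \<in> measure_support M"
      unfolding measure_support_def
    proof (intro CollectI allI impI)
      fix U assume "open U" "y \<in> U"
      then obtain V where V: "V \<in> B" "y \<in> V" "V \<subseteq> U"
        using topological_basisE[OF B(2)] by metis
      with elim have "0 < emeasure M V"
        by (auto simp: zero_less_iff_neq_zero)
      also have "\<dots> \<le> emeasure M U"
        using V \<open>open U\<close> by (intro emeasure_mono) (auto simp: sets_M)
      finally show "0 < emeasure M U" .
    qed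
    with subset show ?case by blast
  qed
qed

text \<open>The value \<phi> x is attained, so lower semicontinuity of the value map approximates it
  by values of \<open>h\<close> in nearby fibres, and these bound \<phi> from above there. Sequences
  suffice by first countability.\<close>

lemma open_sublevel_min:
  fixes h :: "'a::first_countable_topology \<times> 'b::topological_space \<Rightarrow> real"
  assumes lsc: "lsc_map (\<lambda>x. (\<lambda>y. h (x, y)) ` F x)"
    and attained: "\<And>x. \<exists>y\<in>F x. h (x, y) = \<phi> x"
    and lower: "\<And>x y. y \<in> F x \<Longrightarrow> \<phi> x \<le> h (x, y)"
  shows "open {x. \<phi> x < c}"
proof -
  have "\<forall>\<^sub>F n in sequentially. \<phi> (xs n) < c" if x: "\<phi> x < c" and xs: "xs \<longlonglongrightarrow> x" for x xs
  proof -
    have "\<phi> x \<in> (\<lambda>y. h (x, y)) ` F x"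
      using attained[of x] by (metis imageI)
    then obtain ys where ys: "\<And>n. ys n \<in> (\<lambda>y. h (xs n, y)) ` F (xs n)" "ys \<longlonglongrightarrow> \<phi> x"
      using lsc xs unfolding lsc_map_def by blast
    from order_tendstoD(2)[OF ys(2) x] show ?thesis
    proof eventually_elim
      case (elim n)
      then show ?case using ys(1)[of n] lower[of _ "xs n"] by force
    qed
  qed
  then have "\<forall>\<^sub>F x' in nhds x. \<phi> x' < c" if "\<phi> x < c" for x
    using that by (simp add: eventually_nhds_iff_sequentially)
  then show ?thesis
    unfolding open_subopen[of "{x. \<phi> x < c}"] eventually_nhds by (simp add: subset_eq)
qed

text \<open>If the inequality failed in the limit, some \<open>c\<close> would lie strictly between;
  semicontinuity then puts \<open>h\<close> above \<open>c\<close> and \<phi> below \<open>c\<close>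
  along the sequence.\<close>

lemma closed_argmin_graph:
  fixes h :: "'a::metric_space \<times> 'b::metric_space \<Rightarrow> real"
  assumes "closed Z" and lsc: "lsc_on Z h" and usc: "\<And>c. open {x. \<phi> x < c}"
  shows "closed {z \<in> Z. h z \<le> \<phi> (fst z)}"
  unfolding closed_sequential_limits
proof (intro allI impI, elim conjE)
  fix zs z
  assume zs: "\<forall>n. zs n \<in> {z \<in> Z. h z \<le> \<phi> (fst z)}" and z: "zs \<longlonglongrightarrow> z"
  have "z \<in> Z"
    using closed_sequentially[OF \<open>closed Z\<close> _ z] zs by blast
  have "h z \<le> \<phi> (fst z)"
  proof (rule ccontr)
    assume "\<not> ?thesis"
    then obtain c where c: "\<phi> (fst z) < c" "c < h z"
      using dense by (meson not_le)
    have "\<forall>\<^sub>F w in at z within Z. c < h w"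
      using lsc c \<open>z \<in> Z\<close> by (auto simp: lsc_on_def)
    then obtain U where U: "open U" "z \<in> U" "\<forall>w\<in>U. w \<noteq> z \<longrightarrow> w \<in> Z \<longrightarrow> c < h w"
      by (auto simp: eventually_at_topological)
    have "\<forall>\<^sub>F n in sequentially. zs n \<in> U"
      by (rule topological_tendstoD[OF z U(1,2)])
    moreover have "\<forall>\<^sub>F n in sequentially. fst (zs n) \<in> {x. \<phi> x < c}"
      by (rule topological_tendstoD[OF tendsto_fst[OF z] usc]) (simp add: c)
    ultimately have "\<forall>\<^sub>F n in sequentially. False"
    proof eventually_elim
      case (elim n)
      \<comment> \<open>The filter \<open>at z within Z\<close> omits \<open>z\<close> itself, so
        terms equal to \<open>z\<close> are treated separately.\<close>
      with U(3) zs c show ?case by (cases "zs n = z") force+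
    qed
    then show False by simp
  qed
  with \<open>z \<in> Z\<close> show "z \<in> {z \<in> Z. h z \<le> \<phi> (fst z)}" by simp
qed

text \<open>Pushing \<open>m\<close> forward along the graph of an almost everywhere selector of
  \<open>C\<close> keeps the first marginal.\<close>

lemma marginal_probs_concentrated:
  fixes F :: "'a::polish_space \<Rightarrow> 'b::polish_space set"
  assumes C: "closed C" "C \<subseteq> graph_of F" and full: "\<And>x. \<exists>y. (x, y) \<in> C"
    and m: "m \<in> space (prob_algebra borel)"
  obtains \<mu> where "\<mu> \<in> marginal_probs F m" "AE z in \<mu>. z \<in> C"
proof -
  let ?N = "restrict_space borel (graph_of F) :: ('a \<times> 'b) measure"
  have sets_m: "sets m = sets borel" and "prob_space m"
    using m by (auto simp: space_prob_algebra)
  interpret prob_space m by fact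
  obtain s where s: "s \<in> borel_measurable m" and s_C: "AE x in m. (x, s x) \<in> C"
    using AE_measurable_selector[OF C(1) full \<open>prob_space m\<close> sets_m] .
  obtain z0 where z0: "z0 \<in> C" using full by blast
  \<comment> \<open>The default \<open>z0\<close> makes \<open>T\<close> map everything into
    \<open>C\<close>; it changes the first coordinate only on a null set.\<close>
  define T where "T x = (if (x, s x) \<in> C then (x, s x) else z0)" for x
  have "(\<lambda>x. (x, s x)) \<in> m \<rightarrow>\<^sub>M borel \<Otimes>\<^sub>M borel"
    using s by (intro measurable_Pair measurable_ident_sets sets_m)
  then have [measurable]: "(\<lambda>x. (x, s x)) \<in> m \<rightarrow>\<^sub>M borel"
    by (simp add: borel_prod)
  have [measurable]: "C \<in> sets borel" using C(1) by simp
  have "T \<in> m \<rightarrow>\<^sub>M borel"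
    unfolding T_def by measurable
  moreover have T_C: "T x \<in> C" for x
    using z0 by (simp add: T_def)
  ultimately have T: "T \<in> m \<rightarrow>\<^sub>M ?N"
    using C(2) by (intro measurable_restrict_space2) auto
  show thesis
  proof
    have "distr (distr m ?N T) borel fst = distr m borel (\<lambda>x. fst (T x))"
      using T by (subst distr_distr) (auto simp: comp_def)
    also have "\<dots> = distr m borel (\<lambda>x. x)"
    proof (rule distr_cong_AE)
      show "AE x in m. fst (T x) = x"
        using s_C by eventually_elim (simp add: T_def)
      show "(\<lambda>x. fst (T x)) \<in> borel_measurable m"
        using measurable_compose[OF T measurable_fst_graph] .
    qed (auto simp: sets_m measurable_ident_sets)
    also have "\<dots> = m"
      by (rule distr_id2[OF sets_m[symmetric]])
    finally show "distr m ?N T \<in> marginal_probs F m"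
      using prob_space_distr[OF T] by (simp add: marginal_probs_def space_prob_algebra)
    have "{z \<in> space ?N. z \<in> C} \<in> sets ?N"
      using C by (auto simp: sets_restrict_space space_restrict_space intro!: image_eqI[of _ _ C])
    then show "AE z in distr m ?N T. z \<in> C"
      using T T_C by (simp add: AE_distr_iff)
  qed
qed

text \<open>The integral of \<phi> depends only on the marginal and bounds every cost from below. A
  measure concentrated on the argmin graph attains it, so optimality means that the nonnegative gap
  between \<open>h\<close> and \<phi> has integral zero.\<close>

lemma marginal_probs_linear_minimizer_iff:
  fixes F :: "'a::polish_space \<Rightarrow> 'b::polish_space set" and h :: "'a \<times> 'b \<Rightarrow> real"
  assumes h: "h \<in> borel_measurable (restrict_space borel (graph_of F))" "bounded (h ` graph_of F)"
    and graph: "closed (graph_of F)" and lsc: "lsc_on (graph_of F) h"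
    and usc: "\<And>c. open {x. \<phi> x < c}"
    and attained: "\<And>x. \<exists>y\<in>F x. h (x, y) = \<phi> x"
    and lower: "\<And>x y. y \<in> F x \<Longrightarrow> \<phi> x \<le> h (x, y)"
    and m: "m \<in> space (prob_algebra borel)" and \<mu>0: "\<mu>0 \<in> marginal_probs F m"
  shows "(\<forall>\<mu>\<in>marginal_probs F m. (\<integral>z. h z \<partial>\<mu>0) \<le> (\<integral>z. h z \<partial>\<mu>)) \<longleftrightarrow>
    (AE z in \<mu>0. h z = \<phi> (fst z))"
proof -
  have \<phi>[measurable]: "\<phi> \<in> borel_measurable borel"
    by (rule borel_measurableI_less) (simp add: usc)
  have \<phi>_fst: "(\<lambda>z. \<phi> (fst z)) \<in> borel_measurable (restrict_space borel (graph_of F))"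
    using measurable_compose[OF measurable_fst_graph \<phi>] .
  have "bounded ((\<lambda>z. \<phi> (fst z)) ` graph_of F)"
  proof (rule bounded_subset[OF h(2)], rule image_subsetI)
    fix z assume "z \<in> graph_of F"
    obtain y where "y \<in> F (fst z)" "h (fst z, y) = \<phi> (fst z)" using attained by blast
    then show "\<phi> (fst z) \<in> h ` graph_of F"
      by (intro image_eqI[of _ _ "(fst z, y)"]) (auto simp: graph_of_def)
  qed
  then have int: "integrable \<mu> h" "integrable \<mu> (\<lambda>z. \<phi> (fst z))" if "\<mu> \<in> marginal_probs F m" for \<mu>
    using marginal_probs_integrable[OF that h] marginal_probs_integrable[OF that \<phi>_fst] by auto
  have marginal: "(\<integral>z. \<phi> (fst z) \<partial>\<mu>) = (\<integral>x. \<phi> x \<partial>m)" if "\<mu> \<in> marginal_probs F m" for \<mu>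
    unfolding marginal_probsD(4)[OF that, symmetric]
    by (subst integral_distr) (auto simp: measurable_marginal_probs[OF that])
  have lower_AE: "AE z in \<mu>. \<phi> (fst z) \<le> h z" if "\<mu> \<in> marginal_probs F m" for \<mu>
    using lower by (intro AE_I2) (auto simp: marginal_probsD(3)[OF that] graph_of_def)
  have ge: "(\<integral>x. \<phi> x \<partial>m) \<le> (\<integral>z. h z \<partial>\<mu>)" if "\<mu> \<in> marginal_probs F m" for \<mu>
    unfolding marginal[OF that, symmetric] using int[OF that] lower_AE[OF that] by (intro integral_mono_AE)
  have eq_iff: "(\<integral>z. h z \<partial>\<mu>) = (\<integral>x. \<phi> x \<partial>m) \<longleftrightarrow> (AE z in \<mu>. h z = \<phi> (fst z))"
    if "\<mu> \<in> marginal_probs F m" for \<mu>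
  proof -
    have "(\<integral>z. h z \<partial>\<mu>) = (\<integral>x. \<phi> x \<partial>m) \<longleftrightarrow> (\<integral>z. h z - \<phi> (fst z) \<partial>\<mu>) = 0"
      unfolding marginal[OF that, symmetric] using int[OF that] by simp
    also have "\<dots> \<longleftrightarrow> (AE z in \<mu>. h z - \<phi> (fst z) = 0)"
      using int[OF that] lower_AE[OF that] by (intro integral_nonneg_eq_0_iff_AE) auto
    finally show ?thesis by simp
  qed
  have "closed {z \<in> graph_of F. h z \<le> \<phi> (fst z)}"
    using graph lsc usc by (rule closed_argmin_graph)
  moreover have "\<exists>y. (x, y) \<in> {z \<in> graph_of F. h z \<le> \<phi> (fst z)}" for x
    using attained[of x] by (force simp: graph_of_def)
  ultimately obtain \<mu>1 where \<mu>1: "\<mu>1 \<in> marginal_probs F m" "AE z in \<mu>1. z \<in> {z \<in> graph_of F. h z \<le> \<phi> (fst z)}"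
    using marginal_probs_concentrated[of "{z \<in> graph_of F. h z \<le> \<phi> (fst z)}" F m] m by blast
  have "AE z in \<mu>1. h z = \<phi> (fst z)"
    using \<mu>1(2) lower_AE[OF \<mu>1(1)] by eventually_elim auto
  then have "(\<integral>z. h z \<partial>\<mu>1) = (\<integral>x. \<phi> x \<partial>m)"
    using eq_iff[OF \<mu>1(1)] by simp
  then have "(\<forall>\<mu>\<in>marginal_probs F m. (\<integral>z. h z \<partial>\<mu>0) \<le> (\<integral>z. h z \<partial>\<mu>)) \<longleftrightarrow> (\<integral>z. h z \<partial>\<mu>0) = (\<integral>x. \<phi> x \<partial>m)"
    using ge \<mu>0 \<mu>1(1) by (metis order_antisym)
  then show ?thesis
    using eq_iff[OF \<mu>0] by simp
qed

text \<open>A nonnegative function vanishes almost everywhere iff its integral is zero. This is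
  applied to \<mu>, to \<open>m\<close> and to the fibre measures, linked by the disintegration
  formula; closed zero sets then allow passing to supports.\<close>

lemma is_disintegration_AE_zero_iff:
  fixes F :: "'a::second_countable_topology \<Rightarrow> 'b::second_countable_topology set" and k :: "'a \<times> 'b \<Rightarrow> real"
  assumes dis: "is_disintegration F m \<mu> \<nu>"
    and sets_m: "sets m = sets borel" and \<mu>: "\<mu> \<in> marginal_probs F m"
    and graph: "closed (graph_of F)"
    and k: "k \<in> borel_measurable (restrict_space borel (graph_of F))"
    and nonneg: "\<And>z. z \<in> graph_of F \<Longrightarrow> 0 \<le> k z"
    and closed: "\<And>x. closed {y \<in> F x. k (x, y) = 0}"
  shows "(AE z in \<mu>. k z = 0) \<longleftrightarrow> (AE x in m. measure_support (\<nu> x) \<subseteq> {y \<in> F x. k (x, y) = 0})"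
proof -
  have \<nu>: "\<nu> \<in> borel \<rightarrow>\<^sub>M prob_algebra borel" and conc: "AE x in m. AE y in \<nu> x. y \<in> F x"
    and int: "(\<integral>\<^sup>+ z. ennreal (k z) \<partial>\<mu>) = (\<integral>\<^sup>+ x. (\<integral>\<^sup>+ y\<in>F x. ennreal (k (x, y)) \<partial>\<nu> x) \<partial>m)"
    using dis k nonneg by (auto simp: is_disintegration_def)
  have sets_\<nu>: "sets (\<nu> x) = sets borel" for x
    using measurable_space[OF \<nu>, of x] by (simp add: space_prob_algebra)
  \<comment> \<open>Extension by zero off the closed graph gives a Borel function on the product,
    from which measurability of the inner integrals in \<open>x\<close> follows.\<close>
  have "(\<lambda>z. ennreal (k z) * indicator (graph_of F) z) \<in> borel_measurable borel"
    using k graph by (subst borel_measurable_restrict_space_iff_ennreal[symmetric]) (auto simp: borel_closed)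
  moreover have "(\<lambda>z. ennreal (k z) * indicator (graph_of F) z) = (\<lambda>(x, y). ennreal (k (x, y)) * indicator (F x) y)"
    by (auto simp: graph_of_def indicator_def fun_eq_iff)
  ultimately have meas: "(\<lambda>(x, y). ennreal (k (x, y)) * indicator (F x) y) \<in> borel_measurable (borel \<Otimes>\<^sub>M borel)"
    by (simp add: borel_prod)
  have inner_meas: "(\<lambda>x. \<integral>\<^sup>+ y\<in>F x. ennreal (k (x, y)) \<partial>\<nu> x) \<in> borel_measurable m"
    using nn_integral_measurable_subprob_algebra2[OF meas measurable_prob_algebraD[OF \<nu>]]
    by (simp add: measurable_cong_sets[OF sets_m refl])
  have section_meas: "(\<lambda>y. ennreal (k (x, y)) * indicator (F x) y) \<in> borel_measurable (\<nu> x)" for x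
    using measurable_Pair2[OF meas, of x] by (simp add: measurable_cong_sets[OF sets_\<nu> refl])
  have "(AE z in \<mu>. k z = 0) \<longleftrightarrow> (AE z in \<mu>. ennreal (k z) = 0)"
    using nonneg by (intro AE_cong) (auto simp: marginal_probsD(3)[OF \<mu>] ennreal_eq_0_iff intro: antisym)
  also have "\<dots> \<longleftrightarrow> (\<integral>\<^sup>+ z. ennreal (k z) \<partial>\<mu>) = 0"
    using k by (subst nn_integral_0_iff_AE) (auto simp: measurable_marginal_probs[OF \<mu>])
  also have "\<dots> \<longleftrightarrow> (AE x in m. (\<integral>\<^sup>+ y\<in>F x. ennreal (k (x, y)) \<partial>\<nu> x) = 0)"
    unfolding int by (rule nn_integral_0_iff_AE[OF inner_meas])
  also have "\<dots> \<longleftrightarrow> (AE x in m. AE y in \<nu> x. ennreal (k (x, y)) * indicator (F x) y = 0)"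
    by (simp only: nn_integral_0_iff_AE[OF section_meas])
  also have "\<dots> \<longleftrightarrow> (AE x in m. AE y in \<nu> x. y \<in> {y \<in> F x. k (x, y) = 0})"
  proof -
    have pt: "y \<in> F x \<Longrightarrow> ennreal (k (x, y)) * indicator (F x) y = 0 \<longleftrightarrow> y \<in> {y \<in> F x. k (x, y) = 0}" for x y
      using nonneg[of "(x, y)"] by (auto simp: graph_of_def ennreal_eq_0_iff)
    \<comment> \<open>Off \<open>F x\<close> the indicator makes the left condition true and the
      right one false, so concentration of the fibre measures is essential.\<close>
    have "AE x in m. (AE y in \<nu> x. ennreal (k (x, y)) * indicator (F x) y = 0) \<longleftrightarrow>
        (AE y in \<nu> x. y \<in> {y \<in> F x. k (x, y) = 0})"
      using conc
    proof eventually_elim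
      case (elim x)
      then have "AE y in \<nu> x. (ennreal (k (x, y)) * indicator (F x) y = 0) = (y \<in> {y \<in> F x. k (x, y) = 0})"
        by eventually_elim (rule pt)
      then show ?case by (rule eventually_subst)
    qed
    then show ?thesis by (rule eventually_subst)
  qed
  also have "\<dots> \<longleftrightarrow> (AE x in m. measure_support (\<nu> x) \<subseteq> {y \<in> F x. k (x, y) = 0})"
    by (simp only: measure_support_subset_iff[OF sets_\<nu> closed])
  finally show ?thesis .
qed

theorem theorem3p4:
  fixes F :: "'a::polish_space \<Rightarrow> 'b::polish_space set"
    and g :: "'a \<times> 'b \<Rightarrow> 'h::{real_inner, banach, second_countable_topology}"
    and f :: "'h \<Rightarrow> real"
    and m :: "'a measure"
    and \<mu>bar :: "('a \<times> 'b) measure"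
    and lambar :: 'h
    and L :: real
  assumes F_nonempty: "\<And>x. F x \<noteq> {}"
    and F_closed_graph: "closed (graph_of F)"
    and g_measurable: "g \<in> borel_measurable (restrict_space borel (graph_of F))"
    and f_measurable: "f \<in> borel_measurable borel"
    and m_prob: "m \<in> space (prob_algebra borel)"
    and g_bounded: "bounded (g ` graph_of F)"
    and f_convex: "convex_on UNIV f"
    and f_differentiable: "\<And>x. f differentiable (at x)"
    and gradient_Lipschitz: "L-lipschitz_on UNIV (gradient f)"
    and \<mu>bar: "\<mu>bar \<in> marginal_probs F m"
    and lambar: "lambar = gradient f (\<integral>z. g z \<partial>\<mu>bar)"
  shows
    "(is_arg_min (\<lambda>\<mu>. f (\<integral>z. g z \<partial>\<mu>)) (\<lambda>\<mu>. \<mu> \<in> marginal_probs F m) \<mu>bar \<longleftrightarrow>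
      (\<integral>z. inner lambar (g z) \<partial>\<mu>bar) = (INF \<mu>\<in>marginal_probs F m. \<integral>z. inner lambar (g z) \<partial>\<mu>)) \<and>
     ((\<forall>lam\<in>range (gradient f).
         lsc_on (graph_of F) (\<lambda>z. inner lam (g z)) \<and>
         lsc_map (value_map F g lam) \<and>
         (\<forall>x. best_response F g lam x \<noteq> {})) \<longrightarrow>
      (\<forall>\<mu>x. is_disintegration F m \<mu>bar \<mu>x \<longrightarrow>
         (is_arg_min (\<lambda>\<mu>. f (\<integral>z. g z \<partial>\<mu>)) (\<lambda>\<mu>. \<mu> \<in> marginal_probs F m) \<mu>bar \<longleftrightarrow>
          (\<integral>z. inner lambar (g z) \<partial>\<mu>bar) = (INF \<mu>\<in>marginal_probs F m. \<integral>z. inner lambar (g z) \<partial>\<mu>)) \<and>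
         ((\<integral>z. inner lambar (g z) \<partial>\<mu>bar) = (INF \<mu>\<in>marginal_probs F m. \<integral>z. inner lambar (g z) \<partial>\<mu>) \<longleftrightarrow>
          (AE x in m. measure_support (\<mu>x x) \<subseteq> best_response F g lambar x))))"
    (is "(?min \<longleftrightarrow> ?inf) \<and> (?reg \<longrightarrow> _)")
proof -
  define h where "h z = inner lambar (g z)" for z
  let ?P = "marginal_probs F m"
  have h: "h \<in> borel_measurable (restrict_space borel (graph_of F))"
    unfolding h_def using g_measurable by measurable
  have h_bounded: "bounded (h ` graph_of F)"
    using bounded_linear_image[OF g_bounded bounded_linear_inner_right[of lambar]]
    by (simp add: h_def image_image)
  \<comment> \<open>A real-valued \<open>INF\<close> is a genuine lower bound only for families
    bounded below.\<close>
  have "bdd_below ((\<lambda>\<mu>. \<integral>z. h z \<partial>\<mu>) ` ?P)"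
  proof -
    obtain B where B: "\<And>z. z \<in> graph_of F \<Longrightarrow> \<bar>h z\<bar> \<le> B"
      using h_bounded by (auto simp: bounded_iff)
    have "- B \<le> (\<integral>z. h z \<partial>\<mu>)" if \<mu>: "\<mu> \<in> ?P" for \<mu>
    proof -
      interpret prob_space \<mu> by (rule marginal_probsD[OF \<mu>])
      show ?thesis
        using B by (intro integral_ge_const marginal_probs_integrable[OF \<mu> h h_bounded] AE_I2)
          (force simp: marginal_probsD(3)[OF \<mu>])
    qed
    then show ?thesis by (intro bdd_belowI[of _ "- B"]) auto
  qed
  then have inf_iff: "?inf \<longleftrightarrow> (\<forall>\<mu>\<in>?P. (\<integral>z. h z \<partial>\<mu>bar) \<le> (\<integral>z. h z \<partial>\<mu>))"
    unfolding h_def[symmetric] using \<mu>bar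
    by (metis (no_types, lifting) cINF_greatest cINF_lower empty_iff order_antisym)
  have "?min \<longleftrightarrow> (\<forall>\<mu>\<in>?P. f (\<integral>z. g z \<partial>\<mu>bar) \<le> f (\<integral>z. g z \<partial>\<mu>))"
    using \<mu>bar by (auto simp: is_arg_min_linorder)
  also have "\<dots> \<longleftrightarrow> ?inf"
    unfolding inf_iff h_def using g_measurable g_bounded f_convex _ \<mu>bar
    by (rule marginal_probs_minimizer_iff_linear) (simp add: lambar GDERIV_gradient f_differentiable)
  finally have min_inf: "?min \<longleftrightarrow> ?inf" .
  have "?inf \<longleftrightarrow> (AE x in m. measure_support (\<mu>x x) \<subseteq> best_response F g lambar x)"
    if ?reg and dis: "is_disintegration F m \<mu>bar \<mu>x" for \<mu>x
  proof -
    have "lambar \<in> range (gradient f)" by (simp add: lambar)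
    from bspec[OF \<open>?reg\<close> this]
    have lsc: "lsc_on (graph_of F) h" and map: "lsc_map (\<lambda>x. (\<lambda>y. h (x, y)) ` F x)"
      and br: "\<And>x. best_response F g lambar x \<noteq> {}"
      by (simp_all add: h_def[abs_def] value_map_def[abs_def])
    have best_response: "best_response F g lambar x = {y \<in> F x. \<forall>y'\<in>F x. h (x, y) \<le> h (x, y')}" for x
      by (auto simp: best_response_def is_arg_min_linorder h_def)
    then have "\<forall>x. \<exists>y. y \<in> F x \<and> (\<forall>y'\<in>F x. h (x, y) \<le> h (x, y'))"
      using br by blast
    then obtain b where b: "\<And>x. b x \<in> F x" "\<And>x y. y \<in> F x \<Longrightarrow> h (x, b x) \<le> h (x, y)"
      by metis
    \<comment> \<open>The minimizers \<open>b\<close> come from plain choice and may be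
      nonmeasurable; \<phi> is Borel because its strict sublevel sets are open.\<close>
    define \<phi> where "\<phi> x = h (x, b x)" for x
    have attained: "\<exists>y\<in>F x. h (x, y) = \<phi> x" and lower: "y \<in> F x \<Longrightarrow> \<phi> x \<le> h (x, y)" for x y
      using b by (auto simp: \<phi>_def)
    have usc: "open {x. \<phi> x < c}" for c
      using map attained lower by (rule open_sublevel_min)
    \<comment> \<open>The excess over the fibre minimum is nonnegative on the graph, and its zeros
      in each fibre are the best responses.\<close>
    define k where "k z = h z - \<phi> (fst z)" for z
    have br_eq: "best_response F g lambar x = {y \<in> F x. k (x, y) = 0}" for x
    proof -
      have "(\<forall>y'\<in>F x. h (x, y) \<le> h (x, y')) \<longleftrightarrow> k (x, y) = 0" if "y \<in> F x" for y
      proof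
        assume "\<forall>y'\<in>F x. h (x, y) \<le> h (x, y')"
        then have "h (x, y) \<le> \<phi> x" using b(1)[of x] by (simp add: \<phi>_def)
        with lower[OF that] show "k (x, y) = 0" by (simp add: k_def)
      qed (use lower[of _ x] in \<open>auto simp: k_def\<close>)
      then show ?thesis unfolding best_response by blast
    qed
    have k: "k \<in> borel_measurable (restrict_space borel (graph_of F))"
    proof -
      have "\<phi> \<in> borel_measurable borel"
        by (rule borel_measurableI_less) (simp add: usc)
      from h measurable_compose[OF measurable_fst_graph this] show ?thesis
        unfolding k_def by (rule borel_measurable_diff)
    qed
    have nonneg: "0 \<le> k z" if "z \<in> graph_of F" for z
      using that lower by (auto simp: k_def graph_of_def)
    \<comment> \<open>Each best response set is a section of the closed argmin graph.\<close>
    have "closed {y \<in> F x. k (x, y) = 0}" for x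
    proof -
      have "{y \<in> F x. k (x, y) = 0} = Pair x -` {z \<in> graph_of F. h z \<le> \<phi> (fst z)}"
        using lower[of _ x] by (force simp: k_def graph_of_def)
      moreover have "closed (Pair x -` {z \<in> graph_of F. h z \<le> \<phi> (fst z)})"
        by (intro closed_vimage closed_argmin_graph F_closed_graph lsc usc continuous_intros)
      ultimately show ?thesis by simp
    qed
    then have "(AE x in m. measure_support (\<mu>x x) \<subseteq> best_response F g lambar x) \<longleftrightarrow> (AE z in \<mu>bar. k z = 0)"
      unfolding br_eq using dis \<mu>bar F_closed_graph k nonneg m_prob
      by (intro is_disintegration_AE_zero_iff[symmetric]) (auto simp: space_prob_algebra)
    also have "\<dots> \<longleftrightarrow> (AE z in \<mu>bar. h z = \<phi> (fst z))"
      by (simp add: k_def)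
    also have "\<dots> \<longleftrightarrow> ?inf"
      unfolding inf_iff using h h_bounded F_closed_graph lsc usc attained lower m_prob \<mu>bar
      by (rule marginal_probs_linear_minimizer_iff[symmetric])
    finally show ?thesis by simp
  qed
  with min_inf show ?thesis by blast
qed

end
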